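(* For positive integers $M$ and $N$, the following two identities hold: \[ \text{(1)}\quad \overline{\left[\begin{matrix} M+N \\ N\end{matrix}\right]} = \overline{\left[\begin{matrix} M+N-1 \\ N-1\end{matrix}\right]} + q^N\, \overline{\left[\begin{matrix} M+N-1 \\ N\end{matrix}\right]} + q^N\, \overline{\left[\begin{matrix} M+N-2 \\ N-1\end{matrix}\right]}, \] \[ \text{(2)}\quad \overline{\left[\begin{matrix} M+N \\ N\end{matrix}\right]} = \overline{\left[\begin{matrix} M+N-1 \\ N\end{matrix}\right]} + q^M\, \overline{\left[\begin{matrix} M+N-1 \\ N-1\end{matrix}\right]} + q^M\, \overline{\left[\begin{matrix} M+N-2 \\ N-1\end{matrix}\right]}. \]
   Context: An overpartition of $n$ is a partition of $n$ in which the last occurrence of each distinct number may be overlined. For non-negative integers $M,N$, an overpartition fits inside an $M\times N$ rectangle if its largest part is $\le M$ and its number of parts is $\le N$ (the empty overpartition always fits). The over $q$-binomial coefficient $\overline{\left[\begin{matrix} M+N \\ N\end{matrix}\right]}$ is the polynomial in $q$ whose coefficient of $q^n$ is the number of overpartitions of $n$ fitting inside an $M\times N$ rectangle. Thus $\overline{\left[\begin{matrix} a \\ b\end{matrix}\right]}$ (for $0\le b\le a$) corresponds to the $(a-b)\times b$ rectangle. *)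

theory Defs
  imports "HOL-Computational_Algebra.Polynomial"
begin

text \<open>
  An overpartition is the weakly decreasing list of its parts, each tagged with a flag saying
  whether that part is overlined; only the last occurrence of a number may carry the flag.
\<close>

definition overpartition_of :: "nat \<Rightarrow> (nat \<times> bool) list \<Rightarrow> bool" where
  "overpartition_of n xs \<longleftrightarrow>
     sorted_wrt (\<ge>) (map fst xs) \<and>
     (\<forall>x\<in>set xs. 0 < fst x) \<and>
     sum_list (map fst xs) = n \<and>
     (\<forall>i j. i < j \<and> j < length xs \<and> fst (xs ! i) = fst (xs ! j) \<longrightarrow> \<not> snd (xs ! i))"

definition fits_in_rectangle :: "nat \<Rightarrow> nat \<Rightarrow> (nat \<times> bool) list \<Rightarrow> bool" where
  "fits_in_rectangle M N xs \<longleftrightarrow> (\<forall>x\<in>set xs. fst x \<le> M) \<and> length xs \<le> N"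

text \<open>
  Only meaningful for \<open>b \<le> a\<close>, as \<open>a - b\<close> is truncated subtraction. The lemma
  \<open>coeff_over_qbinom\<close> below shows that the coefficient sequence does define a polynomial.
\<close>

definition over_qbinom :: "nat \<Rightarrow> nat \<Rightarrow> int poly" where
  "over_qbinom a b =
     Abs_poly (\<lambda>n. int (card {xs. overpartition_of n xs \<and> fits_in_rectangle (a - b) b xs}))"

lemma finite_overpartitions_in_rectangle:
  "finite {xs. overpartition_of n xs \<and> fits_in_rectangle M N xs}"
proof (rule finite_subset)
  show "{xs. overpartition_of n xs \<and> fits_in_rectangle M N xs}
          \<subseteq> {xs. set xs \<subseteq> {..M} \<times> UNIV \<and> length xs \<le> N}"
    by (auto simp: fits_in_rectangle_def)
  show "finite {xs. set xs \<subseteq> {..M} \<times> (UNIV :: bool set) \<and> length xs \<le> N}"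
    by (rule finite_lists_length_le) simp
qed

lemma overpartition_in_rectangle_size_le:
  assumes "overpartition_of n xs" "fits_in_rectangle M N xs"
  shows "n \<le> M * N"
proof -
  have "sum_list (map fst xs) \<le> sum_list (map (\<lambda>_. M) xs)"
    using assms(2) by (intro sum_list_mono) (auto simp: fits_in_rectangle_def)
  also have "\<dots> = length xs * M"
    by (simp add: sum_list_triv)
  also have "\<dots> \<le> N * M"
    using assms(2) by (simp add: fits_in_rectangle_def)
  finally show ?thesis
    using assms(1) by (simp add: overpartition_of_def mult.commute)
qed

lemma coeff_over_qbinom:
  "coeff (over_qbinom a b) n =
     int (card {xs. overpartition_of n xs \<and> fits_in_rectangle (a - b) b xs})"
proof -
  have "int (card {xs. overpartition_of k xs \<and> fits_in_rectangle (a - b) b xs}) = 0"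
    if "(a - b) * b < k" for k
  proof -
    have "{xs. overpartition_of k xs \<and> fits_in_rectangle (a - b) b xs} = {}"
      using overpartition_in_rectangle_size_le[of k _ "a - b" b] that by fastforce
    then show ?thesis by (simp only: card.empty of_nat_0)
  qed
  then show ?thesis
    unfolding over_qbinom_def by (subst coeff_Abs_poly) auto
qed

end

(*
  The second identity classifies overpartitions by their largest part M: it does not occur, or the
  first part is a non-overlined M, or it is an overlined M, which is then the only part of size M.
  The first identity follows algebraically, by induction on M + N: in the difference of two
  instances of the second identity for neighbouring values of N, the induction hypothesis applies
  to every term.
*)

theory Submission
  imports Defs
begin

text \<open>One pairwise relation covers both the weak decrease and the rule on overlining, so that
  prepending a part to a list only compares it with the later parts.\<close>

definition part_order :: "nat \<times> bool \<Rightarrow> nat \<times> bool \<Rightarrow> bool" where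
  "part_order x y \<longleftrightarrow> fst y < fst x \<or> fst y = fst x \<and> \<not> snd x"

definition box :: "nat \<Rightarrow> nat \<Rightarrow> (nat \<times> bool) list set" where
  "box M N = {xs. sorted_wrt part_order xs \<and> (\<forall>x\<in>set xs. 0 < fst x \<and> fst x \<le> M) \<and> length xs \<le> N}"

text \<open>Indexing by the sides of the rectangle avoids truncated subtraction, and a finite sum
  over lists turns disjoint unions into sums of polynomials.\<close>

definition box_gf :: "nat \<Rightarrow> nat \<Rightarrow> int poly" where
  "box_gf M N = (\<Sum>xs\<in>box M N. monom 1 (sum_list (map fst xs)))"

lemma finite_box: "finite (box M N)"
proof (rule finite_subset)
  show "box M N \<subseteq> {xs. set xs \<subseteq> {..M} \<times> UNIV \<and> length xs \<le> N}"
    by (auto simp: box_def)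
  show "finite {xs. set xs \<subseteq> {..M} \<times> (UNIV :: bool set) \<and> length xs \<le> N}"
    by (rule finite_lists_length_le) simp
qed

text \<open>Sortedness and the rule on overlining are both conditions on all pairs of positions
  \<open>i < j\<close>, hence merge into one.\<close>

lemma overpartition_of_iff_sorted_wrt:
  "overpartition_of n xs \<longleftrightarrow>
     sorted_wrt part_order xs \<and> (\<forall>x\<in>set xs. 0 < fst x) \<and> sum_list (map fst xs) = n"
  unfolding overpartition_of_def part_order_def sorted_wrt_map sorted_wrt_iff_nth_less
  by (safe; force)

lemma overpartitions_in_rectangle_eq:
  "{xs. overpartition_of n xs \<and> fits_in_rectangle M N xs}
     = {xs \<in> box M N. sum_list (map fst xs) = n}"
  by (auto simp: overpartition_of_iff_sorted_wrt fits_in_rectangle_def box_def)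

lemma over_qbinom_eq_box_gf: "over_qbinom a b = box_gf (a - b) b"
proof (rule poly_eqI)
  fix n
  have "coeff (box_gf (a - b) b) n
      = (\<Sum>xs\<in>box (a - b) b. if sum_list (map fst xs) = n then 1 else 0)"
    by (simp add: box_gf_def coeff_sum)
  also have "\<dots> = int (card {xs \<in> box (a - b) b. sum_list (map fst xs) = n})"
    by (simp add: sum.If_cases finite_box Int_def)
  finally show "coeff (over_qbinom a b) n = coeff (box_gf (a - b) b) n"
    by (simp add: coeff_over_qbinom overpartitions_in_rectangle_eq)
qed

lemma box_gf_0 [simp]: "box_gf M 0 = 1" "box_gf 0 N = 1"
proof -
  have "box M 0 = {[]}"
    by (auto simp: box_def)
  moreover have "xs = []" if "xs \<in> box 0 N" for xs
    using that by (cases xs) (auto simp: box_def)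
  then have "box 0 N = {[]}"
    by (auto simp: box_def)
  ultimately show "box_gf M 0 = 1" "box_gf 0 N = 1"
    by (simp_all add: box_gf_def)
qed

lemma box_Suc_Suc:
  "box (Suc m) (Suc n) =
     box m (Suc n) \<union> (Cons (Suc m, False) ` box (Suc m) n \<union> Cons (Suc m, True) ` box m n)"
    (is "?L = ?R")
proof (intro equalityI subsetI)
  fix xs assume xs: "xs \<in> ?L"
  show "xs \<in> ?R"
  proof (cases xs)
    case Nil
    then show ?thesis by (simp add: box_def)
  next
    case (Cons x ys)
    obtain p b where x: "x = (p, b)" by (cases x)
    show ?thesis
    proof (cases "p = Suc m")
      case False
      then have "xs \<in> box m (Suc n)"
        using xs by (fastforce simp: box_def part_order_def Cons x)
      then show ?thesis by blast
    next
      case True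
      show ?thesis
      proof (cases b)
        case b: True
        \<comment> \<open>An overlined first part is the last of its size, so the remaining parts
          are strictly smaller.\<close>
        have "ys \<in> box m n"
          using xs True b by (fastforce simp: box_def part_order_def Cons x)
        then show ?thesis using True b Cons x by blast
      next
        case b: False
        have "ys \<in> box (Suc m) n"
          using xs by (simp add: box_def Cons)
        then show ?thesis using True b Cons x by blast
      qed
    qed
  qed
next
  fix xs assume "xs \<in> ?R"
  then show "xs \<in> ?L"
    by (fastforce simp: box_def part_order_def le_less)
qed

lemma box_gf_largest_part:
  "box_gf (Suc m) (Suc n) =
     box_gf m (Suc n) + monom 1 (Suc m) * box_gf (Suc m) n + monom 1 (Suc m) * box_gf m n"
proof -
  have cons: "(\<Sum>xs\<in>Cons (Suc m, b) ` B. monom 1 (sum_list (map fst xs)))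
      = monom (1 :: int) (Suc m) * (\<Sum>xs\<in>B. monom 1 (sum_list (map fst xs)))" for b and B :: "(nat \<times> bool) list set"
    by (simp add: sum.reindex sum_distrib_left mult_monom)
  have "Cons (Suc m, False) ` box (Suc m) n \<inter> Cons (Suc m, True) ` box m n = {}"
    by auto
  moreover have
    "box m (Suc n) \<inter> (Cons (Suc m, False) ` box (Suc m) n \<union> Cons (Suc m, True) ` box m n) = {}"
    by (auto simp: box_def)
  ultimately show ?thesis
    by (simp add: box_gf_def box_Suc_Suc sum.union_disjoint finite_box cons)
qed

text \<open>The boundary values are symmetric in the two arguments; the conclusion is
  \<open>rec\<close> with their roles exchanged. Only ring arithmetic is involved, no
  overpartitions.\<close>

lemma pascal_recurrence_transpose:
  fixes G :: "nat \<Rightarrow> nat \<Rightarrow> 'a :: comm_ring_1"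
  assumes G0: "\<And>m. G m 0 = 1" "\<And>n. G 0 n = 1"
    and rec: "\<And>m n. G (Suc m) (Suc n) = G m (Suc n) + q ^ Suc m * (G (Suc m) n + G m n)"
  shows "G (Suc m) (Suc n) = G (Suc m) n + q ^ Suc n * (G m (Suc n) + G m n)"
proof (induction "m + n" arbitrary: m n rule: less_induct)
  case less
  consider "m = 0" "n = 0" | k where "m = Suc k" "n = 0" | l where "m = 0" "n = Suc l"
    | k l where "m = Suc k" "n = Suc l"
    by (metis not0_implies_Suc)
  then show ?case
  proof cases
    case 1
    then show ?thesis by (simp add: rec[of 0 0] G0)
  next
    case (2 k)
    \<comment> \<open>One factor \<open>q\<close> is split off so that, after the induction
      hypothesis, the rest reassembles into \<open>rec\<close> at \<open>k\<close> and
      \<open>0\<close>.\<close>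
    have "G (Suc m) (Suc n) = G (Suc k) (Suc 0) + q * (q ^ Suc k * (1 + 1))"
      using rec[of "Suc k" 0] 2 by (simp add: G0 ac_simps)
    also have "\<dots> = 1 + q * (G k (Suc 0) + 1) + q * (q ^ Suc k * (1 + 1))"
      using less[of k 0] 2 by (simp add: G0)
    also have "\<dots> = 1 + q * (G (Suc k) (Suc 0) + 1)"
      using rec[of k 0] by (simp add: G0 algebra_simps)
    finally show ?thesis
      using 2 by (simp add: G0)
  next
    case (3 l)
    then show ?thesis
      using less[of 0 l] rec[of 0 "Suc l"] rec[of 0 l]
      by (simp add: G0 algebra_simps)
  next
    case (4 k l)
    have "G (Suc k) (Suc (Suc l)) - G (Suc k) (Suc l)
        = q ^ Suc (Suc l) * (G k (Suc (Suc l)) + G k (Suc l))"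
      "G (Suc (Suc k)) (Suc l) - G (Suc (Suc k)) l
        = q ^ Suc l * (G (Suc k) (Suc l) + G (Suc k) l)"
      "G (Suc k) (Suc l) - G (Suc k) l = q ^ Suc l * (G k (Suc l) + G k l)"
      using less[of k "Suc l"] less[of "Suc k" l] less[of k l] 4 by simp_all
    note IH = this
    \<comment> \<open>Subtracting \<open>rec\<close> for neighbouring second arguments leaves
      exactly the three differences in \<open>IH\<close>.\<close>
    have "G (Suc m) (Suc n) - G (Suc m) n
        = (G (Suc k) (Suc (Suc l)) - G (Suc k) (Suc l))
          + q ^ Suc (Suc k) * ((G (Suc (Suc k)) (Suc l) - G (Suc (Suc k)) l)
                               + (G (Suc k) (Suc l) - G (Suc k) l))"
      using rec[of "Suc k" "Suc l"] rec[of "Suc k" l] 4 by (simp add: algebra_simps)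
    \<comment> \<open>The exchange
      \<open>q ^ Suc (Suc k) * q ^ Suc l = q ^ Suc (Suc l) * q ^ Suc k\<close> gives a common
      factor; each inner bracket is then a right-hand side of \<open>rec\<close> with first argument
      \<open>k\<close>.\<close>
    also have "\<dots> = q ^ Suc (Suc l) *
        ((G k (Suc (Suc l)) + q ^ Suc k * (G (Suc k) (Suc l) + G k (Suc l)))
          + (G k (Suc l) + q ^ Suc k * (G (Suc k) l + G k l)))"
      unfolding IH by (simp add: algebra_simps)
    also have "\<dots> = q ^ Suc n * (G m (Suc n) + G m n)"
      using rec[of k "Suc l"] rec[of k l] 4 by simp
    finally show ?thesis by (simp add: algebra_simps)
  qed
qed

lemma box_gf_number_of_parts:
  "box_gf (Suc m) (Suc n) =
     box_gf (Suc m) n + monom 1 (Suc n) * box_gf m (Suc n) + monom 1 (Suc n) * box_gf m n"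
proof -
  have monom: "monom 1 1 ^ k = (monom 1 k :: int poly)" for k
    by (simp add: monom_power)
  show ?thesis
    using pascal_recurrence_transpose[of box_gf "monom 1 1" m n, unfolded monom]
    by (simp add: box_gf_largest_part distrib_left add.assoc)
qed

theorem theorem1p2:
  fixes M N :: nat
  assumes "0 < M" and "0 < N"
  shows "over_qbinom (M + N) N =
           over_qbinom (M + N - 1) (N - 1)
           + monom 1 N * over_qbinom (M + N - 1) N
           + monom 1 N * over_qbinom (M + N - 2) (N - 1)
       \<and> over_qbinom (M + N) N =
           over_qbinom (M + N - 1) N
           + monom 1 M * over_qbinom (M + N - 1) (N - 1)
           + monom 1 M * over_qbinom (M + N - 2) (N - 1)"
proof -
  \<comment> \<open>With successors the subtractions are exact: the terms on the right belong to the
    rectangles with sides \<open>Suc m\<close> and \<open>n\<close>, \<open>m\<close> and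
    \<open>Suc n\<close>, \<open>m\<close> and \<open>n\<close>.\<close>
  obtain m n where [simp]: "M = Suc m" "N = Suc n"
    using assms by (metis gr0_implies_Suc)
  show ?thesis
    using box_gf_number_of_parts[of m n] box_gf_largest_part[of m n]
    by (simp add: over_qbinom_eq_box_gf)
qed

end
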